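(* The assignment $T\mapsto I$, $U\mapsto u$, $X\mapsto D$ extends (uniquely) to a representation of the double affine Hecke algebra $\mathbb{H}$ on $\mathcal{C}(\mathbb{Z})$; that is, the operators $I,u,D$ on $\mathcal{C}(\mathbb{Z})$ are invertible and satisfy (besides $u^2=1$) $$(I-\tau)(I+\tau^{-1})=0\quad\text{and}\quad uDu=D^{-1}=I^{-1}DI^{-1}.$$
   Context: Fix $\tau\in(0,1)$ and an integer $M>1$. The double affine Hecke algebra $\mathbb{H}$ (type $A_1$, $q=1$) is the complex unital associative algebra generated by invertible elements $T,U,X$ subject to $(T-\tau)(T+\tau^{-1})=0$, $U^2=1$, $UXU=X^{-1}=T^{-1}XT^{-1}$. $\mathcal{C}(\mathbb{Z})$ is the space of functions $f:\mathbb{Z}\to\mathbb{C}$, with $f_n:=f(n)$. The operators $s,u$ on $\mathcal{C}(\mathbb{Z})$ are $(sf)_n=f_{-n}$, $(uf)_n=f_{M-n}$. $D$ is the translation operator $(Df)_n:=f_{n-1}$. The integral-reflection operator is $I:=\tau s+(\tau-\tau^{-1})J$, where $$(Jf)_n:=\begin{cases}-f_{n-2}-f_{n-4}-\dots-f_{-n}&\text{if }n>0,\\0&\text{if }n=0,\\ f_n+f_{n+2}+\dots+f_{-n-2}&\text{if }n<0\end{cases}$$ (sums over indices in steps of $2$, with $|n|$ terms). *)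

theory Defs
  imports
    Complex_Main
    "HOL-Library.Function_Algebras"
    "HOL-Library.Poly_Mapping"
    "HOL-Algebra.QuotRing"
begin

section \<open>The double affine Hecke algebra by generators and relations\<close>

text \<open>
  Words in the generators and their formal inverses form a free monoid, written additively
  (concatenation is \<open>+\<close>, the empty word is \<open>0\<close>), so that the finitely supported functions
  \<open>word \<Rightarrow>\<^sub>0 complex\<close> with the convolution product of \<^theory>\<open>HOL-Library.Poly_Mapping\<close> are the free
  unital associative complex algebra on these letters.
\<close>

datatype gen = GT | GU | GX

datatype letter = Pos gen | Neg gen

datatype word = Word (letters: "letter list")

instantiation word :: monoid_add
begin

definition zero_word :: word where "0 = Word []"

definition plus_word :: "word \<Rightarrow> word \<Rightarrow> word" where "v + w = Word (letters v @ letters w)"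

instance
  by standard (simp_all add: zero_word_def plus_word_def)

end

type_synonym free_alg = "word \<Rightarrow>\<^sub>0 complex"

definition free_const :: "complex \<Rightarrow> free_alg" where
  "free_const c = Poly_Mapping.single 0 c"

definition free_gen :: "gen \<Rightarrow> free_alg" where
  "free_gen g = Poly_Mapping.single (Word [Pos g]) 1"

definition free_inv :: "gen \<Rightarrow> free_alg" where
  "free_inv g = Poly_Mapping.single (Word [Neg g]) 1"

definition free_ring :: "free_alg ring" where
  "free_ring = \<lparr>carrier = UNIV, mult = (*), one = 1, zero = 0, add = (+)\<rparr>"

lemma ring_free_ring: "ring free_ring"
proof (rule ringI)
  show "abelian_group free_ring"
  proof (rule abelian_groupI)
    fix x assume "x \<in> carrier free_ring"
    show "\<exists>y\<in>carrier free_ring. y \<oplus>\<^bsub>free_ring\<^esub> x = \<zero>\<^bsub>free_ring\<^esub>"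
      by (rule bexI[of _ "- x"]) (simp_all add: free_ring_def)
  qed (simp_all add: free_ring_def add_ac)
  show "Group.monoid free_ring"
    by (rule monoidI) (simp_all add: free_ring_def mult.assoc)
qed (simp_all add: free_ring_def distrib_left distrib_right)

text \<open>A relation \<open>a = b\<close> is encoded by the element \<open>a - b\<close>.\<close>

definition daha_rels :: "real \<Rightarrow> free_alg set" where
  "daha_rels \<tau> =
     (let T = free_gen GT; T' = free_inv GT; U = free_gen GU; X = free_gen GX; X' = free_inv GX;
          t = free_const (of_real \<tau>); t' = free_const (of_real (inverse \<tau>))
      in {free_gen g * free_inv g - 1 | g. True} \<union> {free_inv g * free_gen g - 1 | g. True} \<union>
         {(T - t) * (T + t'), U * U - 1, U * X * U - X', X' - T' * X * T'})"

text \<open>\<^const>\<open>genideal\<close> generates two-sided ideals.\<close>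

definition daha_ideal :: "real \<Rightarrow> free_alg set" where
  "daha_ideal \<tau> = Idl\<^bsub>free_ring\<^esub> (daha_rels \<tau>)"

definition daha :: "real \<Rightarrow> free_alg set ring" where
  "daha \<tau> = free_ring Quot daha_ideal \<tau>"

definition daha_class :: "real \<Rightarrow> free_alg \<Rightarrow> free_alg set" where
  "daha_class \<tau> a = daha_ideal \<tau> +>\<^bsub>free_ring\<^esub> a"

definition daha_scale :: "real \<Rightarrow> complex \<Rightarrow> free_alg set \<Rightarrow> free_alg set" where
  "daha_scale \<tau> c h = daha_class \<tau> (free_const c) \<otimes>\<^bsub>daha \<tau>\<^esub> h"

definition daha_T :: "real \<Rightarrow> free_alg set" where "daha_T \<tau> = daha_class \<tau> (free_gen GT)"

definition daha_U :: "real \<Rightarrow> free_alg set" where "daha_U \<tau> = daha_class \<tau> (free_gen GU)"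

definition daha_X :: "real \<Rightarrow> free_alg set" where "daha_X \<tau> = daha_class \<tau> (free_gen GX)"


section \<open>Linear operators on functions on the integers\<close>

type_synonym zfun = "int \<Rightarrow> complex"

definition fscale :: "complex \<Rightarrow> zfun \<Rightarrow> zfun" where
  "fscale c f = (\<lambda>n. c * f n)"

text \<open>The algebra of linear endomorphisms: the product is composition, the sum is pointwise.\<close>

definition End :: "(zfun \<Rightarrow> zfun) ring" where
  "End = \<lparr>carrier = {A. Vector_Spaces.linear fscale fscale A},
          mult = (\<circ>), one = id, zero = (\<lambda>f. 0), add = (\<lambda>A B f. A f + B f)\<rparr>"

definition op_scale :: "complex \<Rightarrow> (zfun \<Rightarrow> zfun) \<Rightarrow> zfun \<Rightarrow> zfun" where
  "op_scale c A = (\<lambda>f. fscale c (A f))"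

lemma vector_space_fscale: "vector_space fscale"
  by unfold_locales (simp_all add: fscale_def fun_eq_iff distrib_left distrib_right mult.assoc)

lemma linear_fscale_iff:
  "Vector_Spaces.linear fscale fscale A \<longleftrightarrow>
     (\<forall>f g. A (f + g) = A f + A g) \<and> (\<forall>c f. A (fscale c f) = fscale c (A f))"
  using vector_space_fscale
  by (simp add: Vector_Spaces.linear_iff_module_hom module_hom_iff module_iff_vector_space)

lemma ring_End: "ring End"
proof (rule ringI)
  show "abelian_group End"
  proof (rule abelian_groupI)
    fix A assume A: "A \<in> carrier End"
    have "(\<lambda>f. - A f) \<in> carrier End"
      using A by (simp add: End_def linear_fscale_iff) (simp add: fscale_def fun_eq_iff)
    moreover have "(\<lambda>f. - A f) \<oplus>\<^bsub>End\<^esub> A = \<zero>\<^bsub>End\<^esub>"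
      by (simp add: End_def)
    ultimately show "\<exists>B\<in>carrier End. B \<oplus>\<^bsub>End\<^esub> A = \<zero>\<^bsub>End\<^esub>"
      by blast
  next
    fix A B assume "A \<in> carrier End" "B \<in> carrier End"
    then show "A \<oplus>\<^bsub>End\<^esub> B \<in> carrier End"
      by (simp add: End_def linear_fscale_iff add_ac)
         (simp add: fscale_def fun_eq_iff distrib_left)
  next
    show "\<zero>\<^bsub>End\<^esub> \<in> carrier End"
      by (simp add: End_def linear_fscale_iff) (simp add: fscale_def fun_eq_iff)
  qed (simp_all add: End_def add_ac)
  show "Group.monoid End"
    by (rule monoidI) (simp_all add: End_def linear_fscale_iff comp_assoc)
next
  fix A B C assume "A \<in> carrier End" "B \<in> carrier End" "C \<in> carrier End"
  then show "(A \<oplus>\<^bsub>End\<^esub> B) \<otimes>\<^bsub>End\<^esub> C = A \<otimes>\<^bsub>End\<^esub> C \<oplus>\<^bsub>End\<^esub> B \<otimes>\<^bsub>End\<^esub> C"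
    by (simp add: End_def comp_def)
next
  fix A B C assume "A \<in> carrier End" "B \<in> carrier End" "C \<in> carrier End"
  then show "C \<otimes>\<^bsub>End\<^esub> (A \<oplus>\<^bsub>End\<^esub> B) = C \<otimes>\<^bsub>End\<^esub> A \<oplus>\<^bsub>End\<^esub> C \<otimes>\<^bsub>End\<^esub> B"
    by (simp add: End_def comp_def linear_fscale_iff)
qed

text \<open>A representation is a homomorphism of unital complex algebras into \<^const>\<open>End\<close>.\<close>

definition daha_rep :: "real \<Rightarrow> (free_alg set \<Rightarrow> zfun \<Rightarrow> zfun) \<Rightarrow> bool" where
  "daha_rep \<tau> \<rho> \<longleftrightarrow>
     \<rho> \<in> ring_hom (daha \<tau>) End \<and>
     (\<forall>c. \<forall>h\<in>carrier (daha \<tau>). \<rho> (daha_scale \<tau> c h) = op_scale c (\<rho> h))"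

definition s_op :: "zfun \<Rightarrow> zfun" where
  "s_op f = (\<lambda>n. f (- n))"

definition u_op :: "int \<Rightarrow> zfun \<Rightarrow> zfun" where
  "u_op M f = (\<lambda>n. f (M - n))"

definition D_op :: "zfun \<Rightarrow> zfun" where
  "D_op f = (\<lambda>n. f (n - 1))"

definition J_op :: "zfun \<Rightarrow> zfun" where
  "J_op f = (\<lambda>n. if n > 0 then - (\<Sum>k\<in>{1..n}. f (n - 2 * k))
                 else if n = 0 then 0
                 else (\<Sum>k\<in>{0..- n - 1}. f (n + 2 * k)))"

definition I_op :: "real \<Rightarrow> zfun \<Rightarrow> zfun" where
  "I_op \<tau> f = fscale (of_real \<tau>) (s_op f) + fscale (of_real (\<tau> - inverse \<tau>)) (J_op f)"

end

theory Submission
  imports Defs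
begin

section \<open>The operator identities\<close>

text \<open>Write c = \<tau> - 1/\<tau>. After a unit shift, the strings of indices summed by J at n
  and at n - 1 differ by a single term, so J D^-1 = D (J - 1) (\<open>J_op_D_inv\<close>). With s
  D^-1 = D s this gives the cross relation I D^-1 = D (I - c) (\<open>I_op_D_inv\<close>). It
  implies that A = I (I - c) - 1 commutes with translations. Since J vanishes at 0, (I f)(0) =
  \<tau> f(0) and hence (A f)(0) = 0; translating, A = 0. Thus I - c inverts I
  (\<open>I_op_I_inv\<close>), which is the quadratic relation, and the cross relation becomes D^-1
  = I^-1 D I^-1. The relation u D u = D^-1 only says that a reflection reverses translations.

  The rest is the universal property of a presented algebra. Linear operators assigned to the
  letters extend to an action \<open>free_eval\<close> of the free algebra. If it kills the
  relators, it kills the ideal they generate and descends to the quotient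
  (\<open>daha_rep_quot_eval\<close>). Conversely, the operators of the generators force those of
  their formal inverses, and words span the algebra (\<open>daha_rep_unique\<close>).\<close>

definition D_inv :: "zfun \<Rightarrow> zfun" where
  "D_inv f = (\<lambda>n. f (n + 1))"

text \<open>This is the inverse predicted by the quadratic relation, which for invertible T reads
  T^-1 = T - (\<tau> - 1/\<tau>). That it inverts I is only proved in \<open>I_op_I_inv\<close> and
  \<open>I_inv_I_op\<close>.\<close>

definition I_inv :: "real \<Rightarrow> zfun \<Rightarrow> zfun" where
  "I_inv \<tau> f = I_op \<tau> f - fscale (of_real (\<tau> - inverse \<tau>)) f"

lemma D_op_inv [simp]: "D_op (D_inv f) = f" "D_inv (D_op f) = f"
  by (simp_all add: D_op_def D_inv_def)

lemma u_op_u_op [simp]: "u_op M (u_op M f) = f"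
  by (simp add: u_op_def)

lemma u_op_D_op_u_op: "u_op M (D_op (u_op M f)) = D_inv f"
  by (simp add: u_op_def D_op_def D_inv_def fun_eq_iff algebra_simps)

lemma J_op_pos: "n > 0 \<Longrightarrow> J_op f n = - (\<Sum>k\<in>{1..n}. f (n - 2 * k))"
  and J_op_zero: "J_op f 0 = 0"
  and J_op_neg: "n < 0 \<Longrightarrow> J_op f n = (\<Sum>k\<in>{0..- n - 1}. f (n + 2 * k))"
  by (simp_all add: J_op_def)

text \<open>For n > 1, shifting n-2, ..., -n by one gives n-1, n-3, ..., 1-n: the string of n - 1
  preceded by n - 1 itself. For n < 0 the string of n - 1 is the longer one, and its first term
  cancels. The signs of n and n - 1 differ in type only at n = 1 and n = 0.\<close>

lemma J_op_D_inv: "J_op (D_inv f) n = J_op f (n - 1) - f (n - 1)"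
proof -
  consider "n > 1" | "n = 1" | "n = 0" | "n < 0" by linarith
  then show ?thesis
  proof cases
    case 1
    have "{1..n} = insert 1 {2..n}"
      using 1 by auto
    moreover have "(\<Sum>k\<in>{2..n}. f (n - 2 * k + 1)) = (\<Sum>k\<in>{1..n - 1}. f (n - 1 - 2 * k))"
      by (rule sum.reindex_bij_witness[of _ "\<lambda>k. k + 1" "\<lambda>k. k - 1"]) (auto simp: algebra_simps)
    ultimately have "(\<Sum>k\<in>{1..n}. f (n - 2 * k + 1)) =
        f (n - 1) + (\<Sum>k\<in>{1..n - 1}. f (n - 1 - 2 * k))"
      by simp
    with 1 show ?thesis
      by (simp add: J_op_pos D_inv_def)
  next
    case 2
    then show ?thesis
      by (simp add: J_op_pos J_op_zero D_inv_def)
  next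
    case 3
    then show ?thesis
      by (simp add: J_op_neg J_op_zero)
  next
    case 4
    have "{0..- (n - 1) - 1} = insert 0 {1..- n}"
      using 4 by auto
    moreover have "(\<Sum>k\<in>{1..- n}. f (n - 1 + 2 * k)) = (\<Sum>k\<in>{0..- n - 1}. f (n + 2 * k + 1))"
      by (rule sum.reindex_bij_witness[of _ "\<lambda>k. k + 1" "\<lambda>k. k - 1"]) (auto simp: algebra_simps)
    ultimately have "(\<Sum>k\<in>{0..- (n - 1) - 1}. f (n - 1 + 2 * k)) =
        f (n - 1) + (\<Sum>k\<in>{0..- n - 1}. f (n + 2 * k + 1))"
      by simp
    with 4 show ?thesis
      by (simp add: J_op_neg D_inv_def)
  qed
qed

lemma I_op_at_zero: "I_op \<tau> f 0 = of_real \<tau> * f 0"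
  by (simp add: I_op_def fscale_def s_op_def J_op_zero)

text \<open>The relation D^-1 = I^-1 D I^-1 multiplied by I on the left. In this form it does not
  presuppose that \<open>I_inv\<close> inverts I, so it can serve to prove that.\<close>

lemma I_op_D_inv: "I_op \<tau> (D_inv f) = D_op (I_inv \<tau> f)"
  by (rule ext, simp add: I_op_def I_inv_def fscale_def s_op_def J_op_D_inv D_op_def,
      simp add: D_inv_def algebra_simps)

lemma J_op_linear:
  "J_op (f + g) = J_op f + J_op g" "J_op (fscale c f) = fscale c (J_op f)"
  by (auto simp: J_op_def fun_eq_iff fscale_def sum.distrib sum_distrib_left)

lemma I_op_linear: "Vector_Spaces.linear fscale fscale (I_op \<tau>)"
  by (simp add: linear_fscale_iff I_op_def J_op_linear)
     (simp add: fscale_def s_op_def fun_eq_iff algebra_simps)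

lemma I_op_add: "I_op \<tau> (f + g) = I_op \<tau> f + I_op \<tau> g"
  and I_op_fscale: "I_op \<tau> (fscale c f) = fscale c (I_op \<tau> f)"
  using I_op_linear by (simp_all add: linear_fscale_iff)

lemma I_op_diff: "I_op \<tau> (f - g) = I_op \<tau> f - I_op \<tau> g"
  using I_op_add[of \<tau> "f - g" g] by (simp add: algebra_simps)

lemma I_inv_linear: "Vector_Spaces.linear fscale fscale (I_inv \<tau>)"
  by (simp add: linear_fscale_iff I_inv_def I_op_add I_op_fscale)
     (simp add: fscale_def fun_eq_iff algebra_simps)

lemma D_op_linear: "Vector_Spaces.linear fscale fscale D_op"
  by (simp add: linear_fscale_iff D_op_def fscale_def fun_eq_iff)

lemma D_inv_linear: "Vector_Spaces.linear fscale fscale D_inv"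
  by (simp add: linear_fscale_iff D_inv_def fscale_def fun_eq_iff)

lemma u_op_linear: "Vector_Spaces.linear fscale fscale (u_op M)"
  by (simp add: linear_fscale_iff u_op_def fscale_def fun_eq_iff)

text \<open>The value of A f at n is the value at 0 of A applied to the translate of f by n; hence
  the induction is over all f at once.\<close>

lemma eq_zero_if_commutes_D_inv:
  assumes comm: "\<And>f. A (D_inv f) = D_inv (A f)" and zero: "\<And>f. A f 0 = 0"
  shows "A f n = 0"
proof (induction n arbitrary: f rule: int_induct[where k = 0])
  case base
  show ?case by (rule zero)
next
  case (step1 i)
  show ?case using step1(2)[of "D_inv f"] unfolding comm by (simp add: D_inv_def)
next
  case (step2 i)
  show ?case using step2(2)[of "D_op f"] fun_cong[OF comm[of "D_op f"], of "i - 1"]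
    by (simp add: D_inv_def del: D_op_inv) (simp add: D_op_def)
qed

text \<open>
  The quadratic relation says that \<open>I - (\<tau> - \<tau>\<^sup>-\<^sup>1)\<close> inverts \<open>I\<close>. By \<open>I_op_D_inv\<close> the operator
  \<open>I\<^sup>2 - (\<tau> - \<tau>\<^sup>-\<^sup>1) I - 1\<close> commutes with translations, so it suffices to evaluate it at \<open>0\<close>, where
  \<open>J\<close> contributes nothing and \<open>I\<close> is multiplication by \<open>\<tau>\<close>.
\<close>

lemma I_op_I_inv:
  assumes "\<tau> \<noteq> 0"
  shows "I_op \<tau> (I_inv \<tau> f) = f"
proof -
  define A where "A f = I_op \<tau> (I_inv \<tau> f) - f" for f
  \<comment> \<open>The cross relation solved for I D, namely I D = D^-1 I + c D. It lets the second
    I in I (I - c) D^-1 move past the translation, and the terms c D (I - c) cancel.\<close>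
  have D: "I_op \<tau> (D_op f) = D_inv (I_op \<tau> f) + fscale (of_real (\<tau> - inverse \<tau>)) (D_op f)" for f
    using arg_cong[OF I_op_D_inv[of \<tau> "D_op f"], of D_inv] by (simp add: I_inv_def)
  have "A f n = 0" for n
  proof (rule eq_zero_if_commutes_D_inv[of A])
    fix f
    have "I_op \<tau> (I_inv \<tau> (D_inv f)) = D_inv (I_op \<tau> (I_inv \<tau> f))"
      by (simp add: I_inv_def[of \<tau> "D_inv f"] I_op_D_inv I_op_diff I_op_fscale D)
    then show "A (D_inv f) = D_inv (A f)"
      by (simp add: A_def) (simp add: D_inv_def fun_eq_iff)
    show "A f 0 = 0"
      using assms by (simp add: A_def I_op_at_zero I_inv_def fscale_def field_simps)
  qed
  then show ?thesis
    by (simp add: A_def fun_eq_iff)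
qed

text \<open>\<open>I_inv\<close> is a polynomial in the linear operator I, so it commutes with I and
  a right inverse is also a left inverse.\<close>

lemma I_inv_I_op:
  assumes "\<tau> \<noteq> 0"
  shows "I_inv \<tau> (I_op \<tau> f) = f"
  using I_op_I_inv[OF assms, of f] by (simp add: I_inv_def I_op_diff I_op_fscale)

lemma I_op_quadratic:
  assumes "\<tau> \<noteq> 0"
  shows "I_op \<tau> (I_op \<tau> f + fscale (of_real (inverse \<tau>)) f) =
    fscale (of_real \<tau>) (I_op \<tau> f + fscale (of_real (inverse \<tau>)) f)"
proof -
  have "I_op \<tau> (I_op \<tau> f) = f + fscale (of_real (\<tau> - inverse \<tau>)) (I_op \<tau> f)"
    using I_op_I_inv[OF assms, of f] by (simp add: I_inv_def I_op_diff I_op_fscale algebra_simps)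
  then show ?thesis
    using assms
    by (simp add: I_op_add I_op_fscale) (simp add: fscale_def fun_eq_iff field_simps)
qed

lemma I_inv_D_op_I_inv:
  assumes "\<tau> \<noteq> 0"
  shows "I_inv \<tau> (D_op (I_inv \<tau> f)) = D_inv f"
  using I_inv_I_op[OF assms, of "D_inv f"] by (simp add: I_op_D_inv)


section \<open>Evaluating the free algebra at linear operators\<close>

lemma free_alg_induct [case_names single add]:
  fixes p :: free_alg
  assumes single: "\<And>w c. P (Poly_Mapping.single w c)"
    and add: "\<And>p q. P p \<Longrightarrow> P q \<Longrightarrow> P (p + q)"
  shows "P p"
proof (induction p rule: update_induct)
  case const
  \<comment> \<open>The zero element is a monomial with coefficient 0.\<close>
  show ?case using single[of 0 0] by simp
next
  case (update p w c)
  have "Poly_Mapping.update w c p = Poly_Mapping.single w c + p"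
    using update(1)
    by (intro poly_mapping_eqI) (auto simp: lookup_update lookup_add lookup_single in_keys_iff when_def)
  then show ?case
    using add[OF single update(3)] by simp
qed

text \<open>With \<open>foldr\<close> the leftmost letter acts last, so concatenation becomes
  composition in the order used by \<open>End\<close>.\<close>

definition word_op :: "(letter \<Rightarrow> zfun \<Rightarrow> zfun) \<Rightarrow> word \<Rightarrow> zfun \<Rightarrow> zfun" where
  "word_op L w = foldr L (letters w)"

definition free_eval :: "(letter \<Rightarrow> zfun \<Rightarrow> zfun) \<Rightarrow> free_alg \<Rightarrow> zfun \<Rightarrow> zfun" where
  "free_eval L p f = (\<lambda>n. \<Sum>w\<in>Poly_Mapping.keys p. Poly_Mapping.lookup p w * word_op L w f n)"

lemma word_op_zero: "word_op L 0 = id"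
  by (simp add: word_op_def zero_word_def fun_eq_iff)

lemma word_op_add: "word_op L (v + w) = word_op L v \<circ> word_op L w"
  by (simp add: word_op_def plus_word_def fun_eq_iff)

lemma free_eval_single: "free_eval L (Poly_Mapping.single w c) = op_scale c (word_op L w)"
  by (simp add: free_eval_def op_scale_def fscale_def fun_eq_iff)

lemma free_eval_add: "free_eval L (p + q) f = free_eval L p f + free_eval L q f"
  using setsum_keys_plus_distrib[of "\<lambda>w c. c * word_op L w f n" p q for n]
  by (simp add: free_eval_def fun_eq_iff distrib_right)

lemma free_eval_diff: "free_eval L (p - q) f = free_eval L p f - free_eval L q f"
  using free_eval_add[of L "p - q" q f] by (simp add: algebra_simps)

lemma free_eval_const: "free_eval L (free_const c) f = fscale c f"
  by (simp add: free_const_def free_eval_single op_scale_def word_op_zero)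

lemma free_eval_one: "free_eval L 1 = id"
  using free_eval_const[of L 1] by (simp add: free_const_def fun_eq_iff fscale_def)

lemma free_eval_gen: "free_eval L (free_gen g) = L (Pos g)"
  and free_eval_inv: "free_eval L (free_inv g) = L (Neg g)"
  by (simp_all add: free_gen_def free_inv_def free_eval_single word_op_def op_scale_def
      fscale_def fun_eq_iff)

locale letter_ops =
  fixes L :: "letter \<Rightarrow> zfun \<Rightarrow> zfun"
  assumes linear: "Vector_Spaces.linear fscale fscale (L l)"
begin

lemma word_op_linear:
  "word_op L w (f + g) = word_op L w f + word_op L w g"
  "word_op L w (fscale c f) = fscale c (word_op L w f)"
proof -
  have "foldr L ls (f + g) = foldr L ls f + foldr L ls g" for ls
    using linear by (induction ls) (simp_all add: linear_fscale_iff)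
  moreover have "foldr L ls (fscale c f) = fscale c (foldr L ls f)" for ls
    using linear by (induction ls) (simp_all add: linear_fscale_iff)
  ultimately show "word_op L w (f + g) = word_op L w f + word_op L w g"
    and "word_op L w (fscale c f) = fscale c (word_op L w f)"
    by (simp_all add: word_op_def)
qed

lemma free_eval_linear: "Vector_Spaces.linear fscale fscale (free_eval L p)"
  unfolding linear_fscale_iff free_eval_def word_op_linear
  by (simp add: fun_eq_iff fscale_def sum.distrib sum_distrib_left distrib_left mult_ac)

text \<open>Both sides are additive in p and in q, which reduces the claim to monomials, where it is
  \<open>word_op_add\<close>. Linearity of the letters is needed to split sums in q and to pull its
  coefficients through the word of p.\<close>

lemma free_eval_mult: "free_eval L (p * q) f = free_eval L p (free_eval L q f)"
proof (induction p rule: free_alg_induct)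
  case (single v c)
  show ?case
  proof (induction q rule: free_alg_induct)
    case (single w d)
    show ?case
      by (simp add: mult_single free_eval_single op_scale_def word_op_add word_op_linear)
         (simp add: fscale_def mult.assoc)
  next
    case (add p q)
    have "free_eval L (Poly_Mapping.single v c) (g + h) =
        free_eval L (Poly_Mapping.single v c) g + free_eval L (Poly_Mapping.single v c) h" for g h
      using free_eval_linear by (simp only: linear_fscale_iff)
    with add show ?case
      by (simp only: distrib_left free_eval_add)
  qed
next
  case (add p q)
  then show ?case
    by (simp add: distrib_right free_eval_add)
qed

lemma free_eval_ring_hom: "free_eval L \<in> ring_hom free_ring End"
  by (rule ring_hom_memI)
     (auto simp: free_ring_def End_def free_eval_linear free_eval_mult free_eval_add free_eval_one)

text \<open>Multiplicativity determines the values on words, the scalars those on monomials, and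
  additivity the rest. Formal inverses are independent letters here, so their values must be
  prescribed too.\<close>

lemma free_eval_unique:
  assumes hom: "\<psi> \<in> ring_hom free_ring End"
    and scale: "\<And>c p. \<psi> (free_const c * p) = op_scale c (\<psi> p)"
    and gen: "\<And>g. \<psi> (free_gen g) = L (Pos g)"
    and inv: "\<And>g. \<psi> (free_inv g) = L (Neg g)"
  shows "\<psi> p = free_eval L p"
proof (induction p rule: free_alg_induct)
  case (single w c)
  have mult: "\<psi> (p * q) = \<psi> p \<circ> \<psi> q" for p q
    using ring_hom_mult[OF hom, of p q] by (simp add: free_ring_def End_def)
  have letter: "\<psi> (Poly_Mapping.single (Word [l]) 1) = L l" for l
    using gen inv by (cases l) (simp_all add: free_gen_def free_inv_def)
  have word: "\<psi> (Poly_Mapping.single (Word ls) 1) = foldr L ls" for ls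
  proof (induction ls)
    case Nil
    show ?case
      using ring_hom_one[OF hom]
      by (simp add: free_ring_def End_def fun_eq_iff flip: zero_word_def)
  next
    case (Cons l ls)
    have "Poly_Mapping.single (Word (l # ls)) (1 :: complex) =
        Poly_Mapping.single (Word [l]) 1 * Poly_Mapping.single (Word ls) 1"
      by (simp add: mult_single plus_word_def)
    with Cons show ?case
      by (simp only: mult letter foldr.simps)
  qed
  have "Poly_Mapping.single w c = free_const c * Poly_Mapping.single (Word (letters w)) 1"
    by (simp add: free_const_def mult_single)
  then have "\<psi> (Poly_Mapping.single w c) = op_scale c (foldr L (letters w))"
    by (simp only: scale word)
  then show ?case
    by (simp add: free_eval_single word_op_def)
next
  case (add p q)
  then show ?case
    using ring_hom_add[OF hom, of p q]
    by (simp add: free_ring_def End_def fun_eq_iff free_eval_add)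
qed

end


section \<open>Representations of the quotient\<close>

lemma ideal_daha_ideal: "ideal (daha_ideal \<tau>) free_ring"
  unfolding daha_ideal_def
  by (rule ring.genideal_ideal[OF ring_free_ring]) (simp add: free_ring_def)

lemma daha_class_ring_hom: "daha_class \<tau> \<in> ring_hom free_ring (daha \<tau>)"
  using ideal.rcos_ring_hom[OF ideal_daha_ideal] by (simp add: daha_class_def[abs_def] daha_def)

lemma carrier_daha: "carrier (daha \<tau>) = range (daha_class \<tau>)"
  by (auto simp: daha_def FactRing_def A_RCOSETS_defs a_r_coset_def daha_class_def free_ring_def)

lemma daha_class_mult: "daha_class \<tau> p \<otimes>\<^bsub>daha \<tau>\<^esub> daha_class \<tau> q = daha_class \<tau> (p * q)"
  using ring_hom_mult[OF daha_class_ring_hom, of p q] by (simp add: free_ring_def)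

lemma daha_class_add: "daha_class \<tau> p \<oplus>\<^bsub>daha \<tau>\<^esub> daha_class \<tau> q = daha_class \<tau> (p + q)"
  using ring_hom_add[OF daha_class_ring_hom, of p q] by (simp add: free_ring_def)

lemma daha_class_one: "\<one>\<^bsub>daha \<tau>\<^esub> = daha_class \<tau> 1"
  using ring_hom_one[OF daha_class_ring_hom, of \<tau>] by (simp add: free_ring_def)

lemma mem_daha_class_iff: "q \<in> daha_class \<tau> p \<longleftrightarrow> (\<exists>i\<in>daha_ideal \<tau>. q = i + p)"
  by (auto simp: daha_class_def a_r_coset_def r_coset_def free_ring_def)

lemma self_mem_daha_class: "p \<in> daha_class \<tau> p"
proof -
  have "0 \<in> daha_ideal \<tau>"
    using additive_subgroup.zero_closed[OF ideal.axioms(1)[OF ideal_daha_ideal]]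
    by (simp add: free_ring_def)
  then show ?thesis
    by (force simp: mem_daha_class_iff)
qed

lemma daha_class_eq_if_rel:
  assumes "p - q \<in> daha_rels \<tau>"
  shows "daha_class \<tau> p = daha_class \<tau> q"
proof -
  interpret ideal "daha_ideal \<tau>" free_ring by (rule ideal_daha_ideal)
  have "p - q \<in> daha_ideal \<tau>"
    using assms ring.genideal_self[OF ring_free_ring, of "daha_rels \<tau>"]
    by (auto simp: daha_ideal_def free_ring_def)
  then have "p \<in> daha_class \<tau> q"
    by (auto simp: mem_daha_class_iff intro!: bexI[of _ "p - q"])
  then show ?thesis
    using a_repr_independence'[of p q] by (simp add: daha_class_def free_ring_def)
qed

context letter_ops
begin

text \<open>The kernel of evaluation is a two-sided ideal containing the relators, hence contains
  the ideal they generate.\<close>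

lemma free_eval_daha_ideal:
  assumes "\<And>p. p \<in> daha_rels \<tau> \<Longrightarrow> free_eval L p = (\<lambda>f. 0)" and "p \<in> daha_ideal \<tau>"
  shows "free_eval L p = (\<lambda>f. 0)"
proof -
  have kernel: "a_kernel free_ring End (free_eval L) = {p. free_eval L p = (\<lambda>f. 0)}"
    by (simp add: a_kernel_def' free_ring_def End_def)
  have "daha_rels \<tau> \<subseteq> a_kernel free_ring End (free_eval L)"
    unfolding kernel using assms(1) by blast
  then have "daha_ideal \<tau> \<subseteq> a_kernel free_ring End (free_eval L)"
    unfolding daha_ideal_def by (rule ring.genideal_minimal[OF ring_free_ring ring_hom_ring.kernel_is_ideal
        [OF ring_hom_ringI2[OF ring_free_ring ring_End free_eval_ring_hom]]])
  with assms(2) show ?thesis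
    unfolding kernel by blast
qed

text \<open>Evaluation at an arbitrary representative of a coset; \<open>quot_eval_class\<close>
  shows independence of the choice, since representatives differ by an element of the ideal.\<close>

definition quot_eval :: "free_alg set \<Rightarrow> zfun \<Rightarrow> zfun" where
  "quot_eval h = free_eval L (SOME p. p \<in> h)"

lemma quot_eval_class:
  assumes "\<And>p. p \<in> daha_rels \<tau> \<Longrightarrow> free_eval L p = (\<lambda>f. 0)"
  shows "quot_eval (daha_class \<tau> p) = free_eval L p"
proof -
  have "(SOME q. q \<in> daha_class \<tau> p) \<in> daha_class \<tau> p"
    using self_mem_daha_class by (rule someI)
  then obtain i where "i \<in> daha_ideal \<tau>" "(SOME q. q \<in> daha_class \<tau> p) = i + p"
    by (auto simp: mem_daha_class_iff)
  then show ?thesis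
    using free_eval_daha_ideal[OF assms, where p = i] by (simp add: quot_eval_def fun_eq_iff free_eval_add)
qed

lemma daha_rep_quot_eval:
  assumes "\<And>p. p \<in> daha_rels \<tau> \<Longrightarrow> free_eval L p = (\<lambda>f. 0)"
  shows "daha_rep \<tau> quot_eval"
proof -
  note ev = quot_eval_class[OF assms]
  have "quot_eval \<in> ring_hom (daha \<tau>) End"
    by (rule ring_hom_memI)
       (auto simp: carrier_daha daha_class_mult daha_class_add daha_class_one ev End_def
         free_eval_linear free_eval_mult free_eval_add free_eval_one)
  then show ?thesis
    by (auto simp: daha_rep_def carrier_daha daha_scale_def daha_class_mult ev free_eval_mult
        free_eval_const op_scale_def)
qed

text \<open>Prescribing the generators suffices: in the quotient a formal inverse is a true inverse,
  so its image is a right inverse of \<open>L (Pos g)\<close> and must equal the left inverse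
  \<open>L (Neg g)\<close>.\<close>

lemma daha_rep_unique:
  assumes rep: "daha_rep \<tau> \<rho>"
    and gen: "\<And>g. \<rho> (daha_class \<tau> (free_gen g)) = L (Pos g)"
    and inverse: "\<And>g f. L (Neg g) (L (Pos g) f) = f"
  shows "\<rho> (daha_class \<tau> p) = free_eval L p"
proof -
  have hom: "\<rho> \<in> ring_hom (daha \<tau>) End"
    using rep by (simp add: daha_rep_def)
  have hom': "\<rho> \<circ> daha_class \<tau> \<in> ring_hom free_ring End"
    using ring_hom_trans[OF daha_class_ring_hom hom] .
  have inv: "\<rho> (daha_class \<tau> (free_inv g)) = L (Neg g)" for g
  proof
    fix f
    have "daha_class \<tau> (free_gen g * free_inv g) = daha_class \<tau> 1"
      by (rule daha_class_eq_if_rel) (auto simp: daha_rels_def Let_def)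
    then have "L (Pos g) (\<rho> (daha_class \<tau> (free_inv g)) f) = f"
      using ring_hom_mult[OF hom', of "free_gen g" "free_inv g"] ring_hom_one[OF hom']
      by (simp add: free_ring_def End_def gen fun_eq_iff)
    then show "\<rho> (daha_class \<tau> (free_inv g)) f = L (Neg g) f"
      using inverse[of g "\<rho> (daha_class \<tau> (free_inv g)) f"] by simp
  qed
  have "\<rho> (daha_class \<tau> (free_const c * p)) = op_scale c (\<rho> (daha_class \<tau> p))" for c p
    using rep by (simp add: daha_rep_def carrier_daha daha_scale_def daha_class_mult)
  then show ?thesis
    using free_eval_unique[OF hom', of p] gen inv by simp
qed

end

section \<open>The letters acting by I, u, D and their inverses, and the defining relations\<close>

fun daha_letter_op :: "real \<Rightarrow> int \<Rightarrow> letter \<Rightarrow> zfun \<Rightarrow> zfun" where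
  "daha_letter_op \<tau> M (Pos GT) = I_op \<tau>"
| "daha_letter_op \<tau> M (Pos GU) = u_op M"
| "daha_letter_op \<tau> M (Pos GX) = D_op"
| "daha_letter_op \<tau> M (Neg GT) = I_inv \<tau>"
| "daha_letter_op \<tau> M (Neg GU) = u_op M"
| "daha_letter_op \<tau> M (Neg GX) = D_inv"

interpretation daha_letter: letter_ops "daha_letter_op \<tau> M" for \<tau> M
  unfolding letter_ops_def
proof
  fix l
  show "Vector_Spaces.linear fscale fscale (daha_letter_op \<tau> M l)"
    by (cases "(\<tau>, M, l)" rule: daha_letter_op.cases)
       (simp_all add: I_op_linear I_inv_linear D_op_linear D_inv_linear u_op_linear)
qed

lemma daha_letter_op_inverse:
  assumes "\<tau> \<noteq> 0"
  shows "daha_letter_op \<tau> M (Pos g) (daha_letter_op \<tau> M (Neg g) f) = f"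
    and "daha_letter_op \<tau> M (Neg g) (daha_letter_op \<tau> M (Pos g) f) = f"
  by (cases g; simp add: I_op_I_inv[OF assms] I_inv_I_op[OF assms])+

lemma free_eval_daha_rels:
  assumes "\<tau> \<noteq> 0" and "p \<in> daha_rels \<tau>"
  shows "free_eval (daha_letter_op \<tau> M) p = (\<lambda>f. 0)"
proof
  fix f
  note eval_simps = free_eval_diff free_eval_add free_eval_one free_eval_gen free_eval_inv
    free_eval_const daha_letter.free_eval_mult
  from assms(2) consider
      g where "p = free_gen g * free_inv g - 1"
    | g where "p = free_inv g * free_gen g - 1"
    | "p = (free_gen GT - free_const (of_real \<tau>)) * (free_gen GT + free_const (of_real (inverse \<tau>)))"
    | "p = free_gen GU * free_gen GU - 1"
    | "p = free_gen GU * free_gen GX * free_gen GU - free_inv GX"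
    | "p = free_inv GX - free_inv GT * free_gen GX * free_inv GT"
    unfolding daha_rels_def Let_def by blast
  then show "free_eval (daha_letter_op \<tau> M) p f = 0"
  proof cases
    case 1
    then show ?thesis
      by (simp add: eval_simps daha_letter_op_inverse[OF assms(1)])
  next
    case 2
    then show ?thesis
      by (simp add: eval_simps daha_letter_op_inverse[OF assms(1)])
  next
    case 3
    then show ?thesis
      using I_op_quadratic[OF assms(1), of f] by (simp only: eval_simps daha_letter_op.simps) simp
  next
    case 4
    then show ?thesis
      by (simp add: eval_simps)
  next
    case 5
    then show ?thesis
      by (simp add: eval_simps u_op_D_op_u_op)
  next
    case 6
    then show ?thesis
      by (simp add: eval_simps I_inv_D_op_I_inv[OF assms(1)])
  qed
qed

section \<open>Inverses and differences in the endomorphism ring, and the conclusion\<close>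

lemma mem_Units_EndI:
  assumes "Vector_Spaces.linear fscale fscale A" "Vector_Spaces.linear fscale fscale B"
    and "\<And>f. A (B f) = f" "\<And>f. B (A f) = f"
  shows "A \<in> Units End" "inv\<^bsub>End\<^esub> A = B"
proof -
  interpret ring End by (rule ring_End)
  have "A \<in> carrier End" "B \<in> carrier End" "A \<otimes>\<^bsub>End\<^esub> B = \<one>\<^bsub>End\<^esub>" "B \<otimes>\<^bsub>End\<^esub> A = \<one>\<^bsub>End\<^esub>"
    using assms by (auto simp: End_def fun_eq_iff)
  then show "A \<in> Units End" "inv\<^bsub>End\<^esub> A = B"
    using inv_unique'[of A B] by (auto simp: Units_def)
qed

text \<open>Subtraction in \<open>End\<close> goes through an abstractly defined additive inverse,
  so its pointwise form is recovered by cancellation from (A - B) + B = A.\<close>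

lemma End_minus:
  assumes "A \<in> carrier End" "B \<in> carrier End"
  shows "A \<ominus>\<^bsub>End\<^esub> B = (\<lambda>f. A f - B f)"
proof -
  interpret ring End by (rule ring_End)
  have "(A \<ominus>\<^bsub>End\<^esub> B) \<oplus>\<^bsub>End\<^esub> B = A"
    using assms by algebra
  then show ?thesis
    by (auto simp: End_def fun_eq_iff algebra_simps)
qed

theorem theorem3p2:
  fixes \<tau> :: real and M :: int
  assumes "0 < \<tau>" and "\<tau> < 1" and "M > 1"
  shows
    "(\<exists>\<rho>. daha_rep \<tau> \<rho> \<and>
          \<rho> (daha_T \<tau>) = I_op \<tau> \<and> \<rho> (daha_U \<tau>) = u_op M \<and> \<rho> (daha_X \<tau>) = D_op \<and>
          (\<forall>\<rho>'. daha_rep \<tau> \<rho>' \<and>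
                \<rho>' (daha_T \<tau>) = I_op \<tau> \<and> \<rho>' (daha_U \<tau>) = u_op M \<and> \<rho>' (daha_X \<tau>) = D_op \<longrightarrow>
                (\<forall>h\<in>carrier (daha \<tau>). \<rho>' h = \<rho> h))) \<and>
     I_op \<tau> \<in> Units End \<and> u_op M \<in> Units End \<and> D_op \<in> Units End \<and>
     u_op M \<otimes>\<^bsub>End\<^esub> u_op M = \<one>\<^bsub>End\<^esub> \<and>
     (I_op \<tau> \<ominus>\<^bsub>End\<^esub> op_scale (of_real \<tau>) \<one>\<^bsub>End\<^esub>) \<otimes>\<^bsub>End\<^esub>
       (I_op \<tau> \<oplus>\<^bsub>End\<^esub> op_scale (of_real (inverse \<tau>)) \<one>\<^bsub>End\<^esub>) = \<zero>\<^bsub>End\<^esub> \<and>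
     u_op M \<otimes>\<^bsub>End\<^esub> D_op \<otimes>\<^bsub>End\<^esub> u_op M = inv\<^bsub>End\<^esub> D_op \<and>
     inv\<^bsub>End\<^esub> D_op = inv\<^bsub>End\<^esub> (I_op \<tau>) \<otimes>\<^bsub>End\<^esub> D_op \<otimes>\<^bsub>End\<^esub> inv\<^bsub>End\<^esub> (I_op \<tau>)"
proof -
  have \<tau>: "\<tau> \<noteq> 0" using assms(1) by simp
  note rels = free_eval_daha_rels[OF \<tau>, of _ M]
  let ?L = "daha_letter_op \<tau> M"
  let ?\<rho> = "daha_letter.quot_eval \<tau> M"
  have ev: "?\<rho> (daha_class \<tau> p) = free_eval ?L p" for p
    by (rule daha_letter.quot_eval_class[OF rels])
  have rep: "daha_rep \<tau> ?\<rho>"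
    by (rule daha_letter.daha_rep_quot_eval[OF rels])
  have gens: "?\<rho> (daha_T \<tau>) = I_op \<tau>" "?\<rho> (daha_U \<tau>) = u_op M" "?\<rho> (daha_X \<tau>) = D_op"
    by (simp_all add: daha_T_def daha_U_def daha_X_def ev free_eval_gen)
  have unique: "\<rho>' h = ?\<rho> h"
    if \<rho>': "daha_rep \<tau> \<rho>'" "\<rho>' (daha_T \<tau>) = I_op \<tau>" "\<rho>' (daha_U \<tau>) = u_op M"
      "\<rho>' (daha_X \<tau>) = D_op" and h: "h \<in> carrier (daha \<tau>)" for \<rho>' h
  proof -
    have "\<rho>' (daha_class \<tau> (free_gen g)) = ?L (Pos g)" for g
      using \<rho>' by (cases g) (simp_all add: daha_T_def daha_U_def daha_X_def)
    then have "\<rho>' (daha_class \<tau> p) = free_eval ?L p" for p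
      by (rule daha_letter.daha_rep_unique[OF \<rho>'(1) _ daha_letter_op_inverse(2)[OF \<tau>]])
    with h show ?thesis
      by (auto simp: carrier_daha ev)
  qed
  note I = mem_Units_EndI[OF I_op_linear I_inv_linear I_op_I_inv[OF \<tau>] I_inv_I_op[OF \<tau>]]
  note D = mem_Units_EndI[OF D_op_linear D_inv_linear D_op_inv]
  note U = mem_Units_EndI[OF u_op_linear u_op_linear u_op_u_op u_op_u_op]
  have "I_op \<tau> \<in> carrier End" "op_scale (of_real \<tau>) \<one>\<^bsub>End\<^esub> \<in> carrier End"
    using I_op_linear
    by (auto simp: End_def linear_fscale_iff op_scale_def fscale_def fun_eq_iff algebra_simps)
  then have "(I_op \<tau> \<ominus>\<^bsub>End\<^esub> op_scale (of_real \<tau>) \<one>\<^bsub>End\<^esub>) \<otimes>\<^bsub>End\<^esub>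
      (I_op \<tau> \<oplus>\<^bsub>End\<^esub> op_scale (of_real (inverse \<tau>)) \<one>\<^bsub>End\<^esub>) = \<zero>\<^bsub>End\<^esub>"
    using I_op_quadratic[OF \<tau>]
    by (simp add: End_minus) (simp add: End_def op_scale_def fun_eq_iff[where 'b = zfun])
  moreover have "u_op M \<otimes>\<^bsub>End\<^esub> u_op M = \<one>\<^bsub>End\<^esub>"
    by (simp add: End_def fun_eq_iff)
  moreover have "u_op M \<otimes>\<^bsub>End\<^esub> D_op \<otimes>\<^bsub>End\<^esub> u_op M = inv\<^bsub>End\<^esub> D_op"
    unfolding D(2) by (simp add: End_def fun_eq_iff[where 'b = zfun] u_op_D_op_u_op)
  moreover have "inv\<^bsub>End\<^esub> D_op = inv\<^bsub>End\<^esub> (I_op \<tau>) \<otimes>\<^bsub>End\<^esub> D_op \<otimes>\<^bsub>End\<^esub> inv\<^bsub>End\<^esub> (I_op \<tau>)"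
    unfolding D(2) I(2) by (simp add: End_def fun_eq_iff[where 'b = zfun] I_inv_D_op_I_inv[OF \<tau>])
  ultimately show ?thesis
    using rep gens unique I(1) D(1) U(1) by blast
qed

end
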